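(* Let $(\mathcal{H},S_b,s)$ be a symmetric $S_b$-metric space, $s\ge 1$, and let $H_b:(\mathcal{CB}(\mathcal{H}))^3\to[0,\infty)$ be the function defined, for $P,Q,R\in\mathcal{CB}(\mathcal{H})$, by $$H_b(P,Q,R)=\max\Big\{\max\big\{\sup_{p\in P}D_b(p,R),\ \sup_{p\in P}D_b(p,Q)\big\},\ \max\big\{\sup_{r\in R}D_b(r,P),\ \sup_{r\in R}D_b(r,Q)\big\},\ \max\big\{\sup_{q\in Q}D_b(q,P),\ \sup_{q\in Q}D_b(q,R)\big\}\Big\}.$$ Then there exists a real number $k\ge 1$ such that $(\mathcal{CB}(\mathcal{H}),H_b,k)$ is an $S_b$-metric space.
   Context: An $S_b$-metric space is a triple $(X,S_b,s)$ where $X$ is a non-empty set, $s\ge 1$ is a real number, and $S_b:X^3\to[0,\infty)$ satisfies, for all $u,w,v,t\in X$: (i) $S_b(u,w,v)=0$ if and only if $u=w=v$; (ii) $S_b(u,w,v)\le s[S_b(u,u,t)+S_b(w,w,t)+S_b(v,v,t)]$. It is symmetric if $S_b(u,u,w)=S_b(w,w,u)$ for all $u,w\in X$. A sequence $(h_n)$ in $\mathcal{H}$ converges to $h\in\mathcal{H}$ if $S_b(h_n,h_n,h)\to 0$ as $n\to\infty$. A subset $K\subseteq\mathcal{H}$ is closed if it contains every point $x\in\mathcal{H}$ that is the limit of some sequence of points of $K$. A subset $K$ is bounded if $\sup\{S_b(h,u,v): h,u,v\in K\}<\infty$. $\mathcal{CB}(\mathcal{H})$ denotes the set of all non-empty closed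 and bounded subsets of $\mathcal{H}$. For $h\in\mathcal{H}$ and $R\in\mathcal{CB}(\mathcal{H})$, $D_b(h,R)=\inf\{S_b(h,h,r): r\in R\}$. *)

theory Defs
  imports Complex_Main
begin

locale Sb_metric_space =
  fixes X :: "'a set" and S :: "'a \<Rightarrow> 'a \<Rightarrow> 'a \<Rightarrow> real" and s :: real
  assumes nonempty: "X \<noteq> {}"
    and one_le_s: "s \<ge> 1"
    and nonneg: "\<lbrakk>u \<in> X; w \<in> X; v \<in> X\<rbrakk> \<Longrightarrow> S u w v \<ge> 0"
    and zero_iff: "\<lbrakk>u \<in> X; w \<in> X; v \<in> X\<rbrakk> \<Longrightarrow> S u w v = 0 \<longleftrightarrow> u = w \<and> w = v"
    and triangle: "\<lbrakk>u \<in> X; w \<in> X; v \<in> X; t \<in> X\<rbrakk> \<Longrightarrow>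
      S u w v \<le> s * (S u u t + S w w t + S v v t)"

locale symmetric_Sb_metric_space = Sb_metric_space +
  assumes symmetric: "\<lbrakk>u \<in> X; w \<in> X\<rbrakk> \<Longrightarrow> S u u w = S w w u"

definition Sb_converges :: "('a \<Rightarrow> 'a \<Rightarrow> 'a \<Rightarrow> real) \<Rightarrow> (nat \<Rightarrow> 'a) \<Rightarrow> 'a \<Rightarrow> bool" where
  "Sb_converges S h l \<longleftrightarrow> (\<lambda>n. S (h n) (h n) l) \<longlonglongrightarrow> 0"

definition Sb_closed :: "'a set \<Rightarrow> ('a \<Rightarrow> 'a \<Rightarrow> 'a \<Rightarrow> real) \<Rightarrow> 'a set \<Rightarrow> bool" where
  "Sb_closed X S K \<longleftrightarrow>
    K \<subseteq> X \<and> (\<forall>x\<in>X. (\<exists>h. (\<forall>n. h n \<in> K) \<and> Sb_converges S h x) \<longrightarrow> x \<in> K)"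

definition Sb_bounded :: "'a set \<Rightarrow> ('a \<Rightarrow> 'a \<Rightarrow> 'a \<Rightarrow> real) \<Rightarrow> 'a set \<Rightarrow> bool" where
  "Sb_bounded X S K \<longleftrightarrow> K \<subseteq> X \<and> bdd_above {S h u v | h u v. h \<in> K \<and> u \<in> K \<and> v \<in> K}"

definition CB :: "'a set \<Rightarrow> ('a \<Rightarrow> 'a \<Rightarrow> 'a \<Rightarrow> real) \<Rightarrow> 'a set set" where
  "CB X S = {K. K \<noteq> {} \<and> Sb_closed X S K \<and> Sb_bounded X S K}"

definition D\<^sub>b :: "('a \<Rightarrow> 'a \<Rightarrow> 'a \<Rightarrow> real) \<Rightarrow> 'a \<Rightarrow> 'a set \<Rightarrow> real" where
  "D\<^sub>b S h R = (INF r\<in>R. S h h r)"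

text \<open>The suprema are taken in the reals, where the supremum of an unbounded set is
  unspecified; for arguments in \<open>CB X S\<close> all of them are bounded (\<open>bdd_above_D\<^sub>b\<close> below),
  so they agree with the suprema in the extended reals.\<close>

definition H\<^sub>b :: "('a \<Rightarrow> 'a \<Rightarrow> 'a \<Rightarrow> real) \<Rightarrow> 'a set \<Rightarrow> 'a set \<Rightarrow> 'a set \<Rightarrow> real" where
  "H\<^sub>b S P Q R =
    max (max (max (SUP p\<in>P. D\<^sub>b S p R) (SUP p\<in>P. D\<^sub>b S p Q))
             (max (SUP r\<in>R. D\<^sub>b S r P) (SUP r\<in>R. D\<^sub>b S r Q)))
        (max (SUP q\<in>Q. D\<^sub>b S q P) (SUP q\<in>Q. D\<^sub>b S q R))"

lemma (in Sb_metric_space) bdd_below_S: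
  assumes "p \<in> X" and "R \<subseteq> X"
  shows "bdd_below (S p p ` R)"
  using assms by (auto intro!: bdd_belowI[of _ 0] nonneg)

lemma (in Sb_metric_space) bdd_above_D\<^sub>b:
  assumes P: "P \<in> CB X S" and R: "R \<in> CB X S"
  shows "bdd_above ((\<lambda>p. D\<^sub>b S p R) ` P)"
proof -
  have PX: "P \<subseteq> X" and RX: "R \<subseteq> X"
    and bd: "bdd_above {S h u v | h u v. h \<in> P \<and> u \<in> P \<and> v \<in> P}"
    using P R by (auto simp: CB_def Sb_closed_def Sb_bounded_def)
  obtain p\<^sub>0 r\<^sub>0 where p0: "p\<^sub>0 \<in> P" and r0: "r\<^sub>0 \<in> R"
    using P R by (auto simp: CB_def)
  obtain M where "\<And>x. x \<in> {S h u v | h u v. h \<in> P \<and> u \<in> P \<and> v \<in> P} \<Longrightarrow> x \<le> M"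
    using bd unfolding bdd_above_def by blast
  then have M: "S p p p\<^sub>0 \<le> M" if "p \<in> P" for p
    using that p0 by blast
  have "D\<^sub>b S p R \<le> s * (M + M + S r\<^sub>0 r\<^sub>0 p\<^sub>0)" if p: "p \<in> P" for p
  proof -
    have "D\<^sub>b S p R \<le> S p p r\<^sub>0"
      unfolding D\<^sub>b_def using bdd_below_S p PX RX r0 by (intro cINF_lower) auto
    also have "\<dots> \<le> s * (S p p p\<^sub>0 + S p p p\<^sub>0 + S r\<^sub>0 r\<^sub>0 p\<^sub>0)"
      using p PX RX r0 p0 by (intro triangle) auto
    also have "\<dots> \<le> s * (M + M + S r\<^sub>0 r\<^sub>0 p\<^sub>0)"
      using M[OF p] one_le_s by (intro mult_left_mono) auto
    finally show ?thesis .
  qed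
  then show ?thesis by (rule bdd_aboveI2)
qed

end

theory Submission
  imports Defs
begin

text \<open>Let \<open>e(P, Q)\<close> be the supremum of \<open>D\<^sub>b(p, Q)\<close> over \<open>p\<close> in \<open>P\<close>, so that \<open>H\<^sub>b(P, Q, R)\<close> is the
  largest of the six excesses between distinct arguments. Taking infima in
  \<open>S(p, p, q) \<le> s (2 S(p, p, t) + S(t, t, q))\<close>, which uses symmetry, gives
  \<open>e(P, Q) \<le> s (2 e(P, T) + e(T, Q))\<close>, and hence the triangle inequality for \<open>H\<^sub>b\<close> with
  \<open>k = 2 s\<close>. As \<open>Q\<close> is closed, \<open>e(P, Q) = 0\<close> means \<open>P \<subseteq> Q\<close>.\<close>

definition excess :: "('a \<Rightarrow> 'a \<Rightarrow> 'a \<Rightarrow> real) \<Rightarrow> 'a set \<Rightarrow> 'a set \<Rightarrow> real" where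
  "excess S P Q = (SUP p\<in>P. D\<^sub>b S p Q)"

lemma H\<^sub>b_excess:
  "H\<^sub>b S P Q R =
    max (max (max (excess S P R) (excess S P Q)) (max (excess S R P) (excess S R Q)))
        (max (excess S Q P) (excess S Q R))"
  by (simp add: H\<^sub>b_def excess_def)

lemma CB_subset: "P \<in> CB X S \<Longrightarrow> P \<subseteq> X"
  and CB_nonempty: "P \<in> CB X S \<Longrightarrow> P \<noteq> {}"
  by (auto simp: CB_def Sb_closed_def)

context Sb_metric_space
begin

text \<open>Supplies a member of \<open>CB X S\<close>. A limit \<open>y\<close> of the constant
  sequence \<open>x\<close> makes \<open>S x x y\<close> a constant null sequence, hence zero, so
  \<open>y = x\<close>.\<close>

lemma singleton_in_CB:
  assumes "x \<in> X"
  shows "{x} \<in> CB X S"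
proof -
  have "y = x" if "y \<in> X" "\<forall>n. h n \<in> {x}" "Sb_converges S h y" for y and h :: "nat \<Rightarrow> 'a"
  proof -
    have "(\<lambda>n::nat. S x x y) \<longlonglongrightarrow> 0"
      using that by (simp add: Sb_converges_def)
    then have "S x x y = 0"
      using LIMSEQ_const_iff by blast
    then show ?thesis
      using zero_iff[of x x y] assms that by simp
  qed
  then have "Sb_closed X S {x}"
    unfolding Sb_closed_def using assms by blast
  moreover have "{S h u v | h u v. h \<in> {x} \<and> u \<in> {x} \<and> v \<in> {x}} = {S x x x}"
    by blast
  then have "Sb_bounded X S {x}"
    unfolding Sb_bounded_def using assms by simp
  ultimately show ?thesis
    by (simp add: CB_def)
qed

lemma D\<^sub>b_le: "\<lbrakk>p \<in> X; R \<subseteq> X; r \<in> R\<rbrakk> \<Longrightarrow> D\<^sub>b S p R \<le> S p p r"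
  unfolding D\<^sub>b_def by (intro cINF_lower bdd_below_S)

lemma D\<^sub>b_nonneg: "\<lbrakk>p \<in> X; R \<subseteq> X; R \<noteq> {}\<rbrakk> \<Longrightarrow> D\<^sub>b S p R \<ge> 0"
  unfolding D\<^sub>b_def by (intro cINF_greatest nonneg) auto

lemma D\<^sub>b_self: "\<lbrakk>p \<in> R; R \<subseteq> X\<rbrakk> \<Longrightarrow> D\<^sub>b S p R = 0"
  using D\<^sub>b_le[of p R p] D\<^sub>b_nonneg[of p R] zero_iff[of p p p] by (auto intro: antisym)

text \<open>Boundedness of the members of \<open>CB X S\<close> enters here: it makes the real
  supremum an actual upper bound.\<close>

lemma D\<^sub>b_le_excess:
  "\<lbrakk>P \<in> CB X S; Q \<in> CB X S; p \<in> P\<rbrakk> \<Longrightarrow> D\<^sub>b S p Q \<le> excess S P Q"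
  unfolding excess_def by (intro cSUP_upper bdd_above_D\<^sub>b)

lemma excess_nonneg:
  assumes "P \<in> CB X S" "Q \<in> CB X S"
  shows "excess S P Q \<ge> 0"
proof -
  obtain p where "p \<in> P"
    using CB_nonempty assms by blast
  then have "0 \<le> D\<^sub>b S p Q"
    using assms by (intro D\<^sub>b_nonneg) (auto dest: CB_subset CB_nonempty)
  also have "\<dots> \<le> excess S P Q"
    using assms \<open>p \<in> P\<close> by (intro D\<^sub>b_le_excess)
  finally show ?thesis .
qed

lemma excess_self:
  assumes "P \<in> CB X S"
  shows "excess S P P = 0"
proof -
  have "excess S P P = (SUP p\<in>P. 0::real)"
    unfolding excess_def using assms by (intro SUP_cong) (auto intro: D\<^sub>b_self dest: CB_subset)
  then show ?thesis
    using CB_nonempty[OF assms] by simp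
qed

end

context symmetric_Sb_metric_space
begin

text \<open>A zero infimum yields points of \<open>Q\<close> arbitrarily near \<open>p\<close>. They
  form a sequence converging to \<open>p\<close>, and closedness of \<open>Q\<close> puts
  \<open>p\<close> in \<open>Q\<close>.\<close>

lemma D\<^sub>b_zero_imp_mem:
  assumes Q: "Q \<in> CB X S" and p: "p \<in> X" and zero: "D\<^sub>b S p Q = 0"
  shows "p \<in> Q"
proof -
  have QX: "Q \<subseteq> X"
    using Q by (rule CB_subset)
  have "\<exists>q\<in>Q. S p p q < inverse (real (Suc n))" for n
  proof -
    have "D\<^sub>b S p Q < inverse (real (Suc n))"
      unfolding zero by simp
    then show ?thesis
      unfolding D\<^sub>b_def using Q bdd_below_S[OF p QX] by (subst (asm) cINF_less_iff) (auto dest: CB_nonempty)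
  qed
  then obtain q where q: "\<And>n. q n \<in> Q" "\<And>n. S p p (q n) < inverse (real (Suc n))"
    by metis
  have qX: "q n \<in> X" for n
    using q QX by blast
  have "(\<lambda>n. S (q n) (q n) p) \<longlonglongrightarrow> 0"
  proof (rule tendsto_sandwich)
    show "\<forall>\<^sub>F n in sequentially. 0 \<le> S (q n) (q n) p"
      using nonneg qX p by simp
    show "\<forall>\<^sub>F n in sequentially. S (q n) (q n) p \<le> inverse (real (Suc n))"
      \<comment> \<open>Convergence has the sequence in the first two slots, whereas
        \<open>D\<^sub>b\<close> has the fixed point there; symmetry exchanges the two.\<close>
      using q symmetric[OF qX p] by (simp add: less_imp_le)
  qed (rule tendsto_const LIMSEQ_inverse_real_of_nat)+
  then show ?thesis
    using Q p q unfolding CB_def Sb_closed_def Sb_converges_def by blast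
qed

lemma excess_nonpos_imp_subset:
  assumes "P \<in> CB X S" "Q \<in> CB X S" "excess S P Q \<le> 0"
  shows "P \<subseteq> Q"
proof
  fix p assume p: "p \<in> P"
  then have pX: "p \<in> X"
    using assms CB_subset by blast
  have "D\<^sub>b S p Q \<le> 0"
    using D\<^sub>b_le_excess[OF assms(1,2) p] assms(3) by simp
  then have "D\<^sub>b S p Q = 0"
    using D\<^sub>b_nonneg[OF pX CB_subset CB_nonempty] assms(2) by (intro antisym)
  then show "p \<in> Q"
    using D\<^sub>b_zero_imp_mem assms(2) pX by blast
qed

lemma D\<^sub>b_triangle:
  assumes p: "p \<in> X" and Q: "Q \<in> CB X S" and T: "T \<in> CB X S"
  shows "D\<^sub>b S p Q \<le> s * (2 * D\<^sub>b S p T + excess S T Q)"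
proof -
  have QX: "Q \<subseteq> X" and TX: "T \<subseteq> X"
    using Q T by (auto dest: CB_subset)
  have s: "s > 0"
    using one_le_s by simp
  \<comment> \<open>Isolating first \<open>S t t q\<close> and then \<open>S p p t\<close> leaves a
    left side constant in \<open>q\<close>, respectively \<open>t\<close>, so that each infimum can
    be taken by \<open>cINF_greatest\<close>.\<close>
  have "D\<^sub>b S p Q / s - excess S T Q \<le> 2 * S p p t" if t: "t \<in> T" for t
  proof -
    have "D\<^sub>b S p Q / s - 2 * S p p t \<le> S t t q" if q: "q \<in> Q" for q
    proof -
      have "D\<^sub>b S p Q \<le> S p p q"
        using p QX q by (rule D\<^sub>b_le)
      also have "\<dots> \<le> s * (S p p t + S p p t + S q q t)"
        using p q t QX TX by (intro triangle) auto
      \<comment> \<open>The axiom measures from \<open>q\<close> to \<open>t\<close>; the infimum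
        over \<open>q\<close> defining \<open>D\<^sub>b S t Q\<close> needs the distance from
        \<open>t\<close>.\<close>
      also have "S q q t = S t t q"
        using q t QX TX by (intro symmetric) auto
      finally show ?thesis
        using s by (simp add: field_simps)
    qed
    then have "D\<^sub>b S p Q / s - 2 * S p p t \<le> D\<^sub>b S t Q"
      unfolding D\<^sub>b_def[of S t] using CB_nonempty[OF Q] by (intro cINF_greatest)
    then show ?thesis
      using D\<^sub>b_le_excess[OF T Q t] by simp
  qed
  then have "(D\<^sub>b S p Q / s - excess S T Q) / 2 \<le> S p p t" if "t \<in> T" for t
    using that by fastforce
  then have "(D\<^sub>b S p Q / s - excess S T Q) / 2 \<le> D\<^sub>b S p T"
    unfolding D\<^sub>b_def[of S p T] using CB_nonempty[OF T] by (intro cINF_greatest)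
  then show ?thesis
    using s by (simp add: field_simps)
qed

lemma excess_triangle:
  assumes P: "P \<in> CB X S" and Q: "Q \<in> CB X S" and T: "T \<in> CB X S"
  shows "excess S P Q \<le> s * (2 * excess S P T + excess S T Q)"
  unfolding excess_def[of S P Q]
proof (rule cSUP_least)
  fix p assume p: "p \<in> P"
  then have "D\<^sub>b S p Q \<le> s * (2 * D\<^sub>b S p T + excess S T Q)"
    using P Q T by (intro D\<^sub>b_triangle) (auto dest: CB_subset)
  also have "\<dots> \<le> s * (2 * excess S P T + excess S T Q)"
    using D\<^sub>b_le_excess[OF P T p] one_le_s by (intro mult_left_mono) auto
  finally show "D\<^sub>b S p Q \<le> s * (2 * excess S P T + excess S T Q)" .
qed (use P CB_nonempty in blast)

lemma H\<^sub>b_zero_iff: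
  assumes P: "P \<in> CB X S" and Q: "Q \<in> CB X S" and R: "R \<in> CB X S"
  shows "H\<^sub>b S P Q R = 0 \<longleftrightarrow> P = Q \<and> Q = R"
proof
  assume zero: "H\<^sub>b S P Q R = 0"
  have "excess S P Q \<le> 0" "excess S Q P \<le> 0" "excess S Q R \<le> 0" "excess S R Q \<le> 0"
    \<comment> \<open>Weakening the equation to \<open>\<le> 0\<close> lets the bound on the maximum
      split into bounds on the single excesses.\<close>
    using eq_refl[OF zero] by (simp_all add: H\<^sub>b_excess)
  then show "P = Q \<and> Q = R"
    using P Q R by (meson excess_nonpos_imp_subset subset_antisym)
next
  assume "P = Q \<and> Q = R"
  then show "H\<^sub>b S P Q R = 0"
    using excess_self[OF P] by (simp add: H\<^sub>b_excess)
qed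

lemma H\<^sub>b_triangle:
  assumes P: "P \<in> CB X S" and Q: "Q \<in> CB X S" and R: "R \<in> CB X S" and T: "T \<in> CB X S"
  shows "H\<^sub>b S P Q R \<le> 2 * s * (H\<^sub>b S P P T + H\<^sub>b S Q Q T + H\<^sub>b S R R T)"
proof -
  \<comment> \<open>With a repeated argument, \<open>H\<^sub>b S A A T\<close> dominates both
    excesses between \<open>A\<close> and \<open>T\<close>.\<close>
  have to: "excess S A T \<le> H\<^sub>b S A A T" and "from": "excess S T A \<le> H\<^sub>b S A A T" for A
    by (simp_all add: H\<^sub>b_excess le_max_iff_disj)
  have nn: "0 \<le> H\<^sub>b S A A T" if "A \<in> CB X S" for A
    using excess_nonneg[OF that T] to[of A] by linarith
  \<comment> \<open>One claim serves all six excesses: \<open>A\<close> and \<open>B\<close> are any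
    two of the three arguments, in either order. The bound \<open>sum\<close> discards the term of
    the third.\<close>
  have le: "excess S A B \<le> 2 * s * (H\<^sub>b S P P T + H\<^sub>b S Q Q T + H\<^sub>b S R R T)"
    if A: "A \<in> CB X S" and B: "B \<in> CB X S"
      and sum: "H\<^sub>b S A A T + H\<^sub>b S B B T \<le> H\<^sub>b S P P T + H\<^sub>b S Q Q T + H\<^sub>b S R R T" for A B
  proof -
    have "excess S A B \<le> s * (2 * excess S A T + excess S T B)"
      using A B T by (rule excess_triangle)
    also have "\<dots> \<le> s * (2 * (H\<^sub>b S P P T + H\<^sub>b S Q Q T + H\<^sub>b S R R T))"
    proof (rule mult_left_mono)
      \<comment> \<open>The two terms have weights 2 and 1. Raising the second to 2, allowed since
        \<open>H\<^sub>b S B B T\<close> is nonnegative, gives the constant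
        \<open>2 * s\<close>.\<close>
      show "2 * excess S A T + excess S T B \<le> 2 * (H\<^sub>b S P P T + H\<^sub>b S Q Q T + H\<^sub>b S R R T)"
        using to[of A] "from"[of B] nn[OF B] sum by argo
    qed (use one_le_s in simp)
    finally show ?thesis
      by (simp only: mult_ac)
  qed
  show ?thesis
    \<comment> \<open>Each instance of \<open>sum\<close> follows from nonnegativity of the term it
      omits.\<close>
    unfolding H\<^sub>b_excess[of S P Q R] using P Q R nn[OF P] nn[OF Q] nn[OF R]
    by (intro max.boundedI le; (assumption | linarith))
qed

end

theorem lemma2p1:
  fixes \<H> :: "'a set" and S\<^sub>b :: "'a \<Rightarrow> 'a \<Rightarrow> 'a \<Rightarrow> real" and s :: real
  assumes "symmetric_Sb_metric_space \<H> S\<^sub>b s"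
  shows "\<exists>k\<ge>1. Sb_metric_space (CB \<H> S\<^sub>b) (H\<^sub>b S\<^sub>b) k"
proof -
  interpret symmetric_Sb_metric_space \<H> S\<^sub>b s
    by (rule assms)
  have "Sb_metric_space (CB \<H> S\<^sub>b) (H\<^sub>b S\<^sub>b) (2 * s)"
  proof
    show "CB \<H> S\<^sub>b \<noteq> {}"
      using nonempty singleton_in_CB by blast
    show "2 * s \<ge> 1"
      using one_le_s by simp
    show "H\<^sub>b S\<^sub>b P Q R \<ge> 0" if "P \<in> CB \<H> S\<^sub>b" "Q \<in> CB \<H> S\<^sub>b" "R \<in> CB \<H> S\<^sub>b" for P Q R
      using excess_nonneg[OF that(1,2)] by (simp add: H\<^sub>b_excess le_max_iff_disj)
  qed (fact H\<^sub>b_zero_iff H\<^sub>b_triangle)+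
  then show ?thesis
    using one_le_s by (intro exI[of _ "2 * s"]) simp
qed

end
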